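(* Let $N,S\ge 1$ be integers, let $\{\phi_j\}_{j=1}^N$ be an orthonormal basis of $\mathbb{C}^N$, let $A_1,\dots,A_S$ be arbitrary complex $N\times N$ matrices, and let $\mathfrak{g}\in\mathbb{C}^N$. For $m=1,\dots,S$ and $\ell=1,\dots,N$ define $\mathfrak{g}_{m,\ell}:=\phi_\ell\circ(A_m\mathfrak{g})\in\mathbb{C}^N$, where $\circ$ is the entrywise product. Let $v=(v_k)_{k=1}^N:=\sum_{j=1}^S|A_j\mathfrak{g}|^2$, where modulus and square are taken entrywise, i.e. $v_k=\sum_{j=1}^S|(A_j\mathfrak{g})_k|^2$. Then the collection $\{\mathfrak{g}_{m,\ell}: m=1,\dots,S,\ \ell=1,\dots,N\}$ forms a frame for $\mathbb{C}^N$ if and only if $v_k>0$ for all $k=1,\dots,N$. Moreover, in that case, for every $\mathfrak{f}\in\mathbb{C}^N$, $$A\,\|\mathfrak{f}\|_2^2\le\sum_{m=1}^S\sum_{\ell=1}^N|\langle\mathfrak{f},\mathfrak{g}_{m,\ell}\rangle|^2\le B\,\|\mathfrak{f}\|_2^2$$ with optimal frame bounds $A:=\min_{1\le k\le N}v_k$ and $B:=\max_{1\le k\le N}v_k$.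
   Context: A finite indexed family $\{\psi_x\}_{x\in X}$ in $\mathbb{C}^N$ is a frame if there are constants $A,B>0$ with $A\|f\|_2^2\le\sum_{x\in X}|\langle f,\psi_x\rangle|^2\le B\|f\|_2^2$ for all $f\in\mathbb{C}^N$. The optimal frame bounds are the largest $A$ and smallest $B$ for which these inequalities hold for all $f$. The inner product is $\langle f,h\rangle=\sum_j f(j)\overline{h(j)}$. *)

theory Defs
  imports "HOL-Analysis.Analysis"
begin

text \<open>
  Vectors of \<open>\<complex>\<^sup>N\<close> are elements of \<^typ>\<open>complex ^ 'n\<close> with \<open>N = CARD('n)\<close>. The library norm on
  this type is the Euclidean norm, and its multiplication \<open>(*)\<close> is the entrywise product.
  The library inner product \<open>(\<bullet>)\<close> is only the real part of the Hermitian one, hence the following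
  definition, linear in the first argument.
\<close>

definition cinner :: "complex ^ 'n \<Rightarrow> complex ^ 'n \<Rightarrow> complex"
  where "cinner f h = (\<Sum>j\<in>UNIV. f $ j * cnj (h $ j))"

text \<open>Here \<open>vec.span\<close> is the span over the scalar field \<open>\<complex>\<close>, not over \<open>\<real>\<close>.\<close>

definition orthonormal_basis :: "('n \<Rightarrow> complex ^ 'n) \<Rightarrow> bool"
  where "orthonormal_basis \<phi> \<longleftrightarrow>
    (\<forall>i j. cinner (\<phi> i) (\<phi> j) = (if i = j then 1 else 0)) \<and> vec.span (range \<phi>) = UNIV"

definition frame_bounds :: "'i set \<Rightarrow> ('i \<Rightarrow> complex ^ 'n) \<Rightarrow> real \<Rightarrow> real \<Rightarrow> bool"
  where "frame_bounds X \<psi> A B \<longleftrightarrow> A > 0 \<and> B > 0 \<and>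
    (\<forall>f. A * (norm f)\<^sup>2 \<le> (\<Sum>x\<in>X. (cmod (cinner f (\<psi> x)))\<^sup>2) \<and>
         (\<Sum>x\<in>X. (cmod (cinner f (\<psi> x)))\<^sup>2) \<le> B * (norm f)\<^sup>2)"

definition is_frame :: "'i set \<Rightarrow> ('i \<Rightarrow> complex ^ 'n) \<Rightarrow> bool"
  where "is_frame X \<psi> \<longleftrightarrow> finite X \<and> (\<exists>A B. frame_bounds X \<psi> A B)"

definition optimal_frame_bounds :: "'i set \<Rightarrow> ('i \<Rightarrow> complex ^ 'n) \<Rightarrow> real \<Rightarrow> real \<Rightarrow> bool"
  where "optimal_frame_bounds X \<psi> A B \<longleftrightarrow> frame_bounds X \<psi> A B \<and>
    (\<forall>A' B'. frame_bounds X \<psi> A' B' \<longrightarrow> A' \<le> A \<and> B \<le> B')"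

definition modulated_window ::
    "('n \<Rightarrow> complex ^ 'n) \<Rightarrow> (nat \<Rightarrow> complex ^ 'n ^ 'n) \<Rightarrow> complex ^ 'n \<Rightarrow> nat \<times> 'n \<Rightarrow> complex ^ 'n"
  where "modulated_window \<phi> A g = (\<lambda>(m, l). \<phi> l * (A m *v g))"

definition energy :: "nat \<Rightarrow> (nat \<Rightarrow> complex ^ 'n ^ 'n) \<Rightarrow> complex ^ 'n \<Rightarrow> real ^ 'n"
  where "energy S A g = (\<chi> k. \<Sum>j=1..S. (cmod ((A j *v g) $ k))\<^sup>2)"

end

(* Parseval's identity for f o conj(A_m g) turns the frame sum into the sum of v_k |f_k|^2,
   so the frame operator is diagonal with entries v_k; the standard unit vectors attain
   its extreme values. *)

theory Submission
  imports Defs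
begin

lemma norm_vec_power2: "(norm (f :: complex ^ 'n))\<^sup>2 = (\<Sum>k\<in>UNIV. (cmod (f $ k))\<^sup>2)"
  by (simp add: norm_vec_def L2_set_def sum_nonneg)

text \<open>The rows of a unitary matrix are orthonormal, hence so are its columns.\<close>

lemma orthonormal_basis_columns:
  fixes \<phi> :: "'n::finite \<Rightarrow> complex ^ 'n"
  assumes "orthonormal_basis \<phi>"
  shows "(\<Sum>l\<in>UNIV. cnj (\<phi> l $ j) * \<phi> l $ k) = (if j = k then 1 else 0)"
proof -
  \<comment> \<open>Row \<open>l\<close> of \<open>U\<close> is \<open>\<phi> l\<close> and
    \<open>V\<close> is the conjugate transpose, so \<open>U ** V\<close> is the Gram matrix of the
    basis.\<close>
  define U V :: "complex ^ 'n ^ 'n"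
    where "U = (\<chi> l k. \<phi> l $ k)" and "V = (\<chi> k l. cnj (\<phi> l $ k))"
  have "U ** V = mat 1"
    using assms
    by (simp add: U_def V_def matrix_matrix_mult_def mat_def vec_eq_iff orthonormal_basis_def cinner_def)
  \<comment> \<open>A one-sided inverse of a square matrix is two-sided; this is the passage from
    rows to columns.\<close>
  then have "V ** U = mat 1"
    by (simp add: matrix_left_right_inverse)
  then have "(V ** U) $ j $ k = mat 1 $ j $ k"
    by simp
  then show ?thesis
    by (simp add: U_def V_def matrix_matrix_mult_def mat_def)
qed

text \<open>Expanding each squared modulus gives a triple sum over \<open>l\<close>,
  \<open>j\<close>, \<open>k\<close>. Summing over \<open>l\<close> first leaves only the diagonal
  terms \<open>j = k\<close>, by orthonormality of the columns.\<close>

lemma parseval: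
  fixes \<phi> :: "'n::finite \<Rightarrow> complex ^ 'n"
  assumes "orthonormal_basis \<phi>"
  shows "(\<Sum>l\<in>UNIV. (cmod (cinner h (\<phi> l)))\<^sup>2) = (norm h)\<^sup>2"
proof -
  \<comment> \<open>The computation runs in the complex numbers, where a squared modulus factors as
    \<open>z * cnj z\<close>; injectivity of \<open>of_real\<close> brings it back at the
    end.\<close>
  have "complex_of_real (\<Sum>l\<in>UNIV. (cmod (cinner h (\<phi> l)))\<^sup>2)
      = (\<Sum>l\<in>UNIV. cinner h (\<phi> l) * cnj (cinner h (\<phi> l)))"
    by (simp only: of_real_sum complex_norm_square)
  also have "\<dots> = (\<Sum>l\<in>UNIV. \<Sum>j\<in>UNIV. \<Sum>k\<in>UNIV. h $ j * cnj (h $ k) * (cnj (\<phi> l $ j) * \<phi> l $ k))"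
    by (simp add: cinner_def sum_product mult_ac)
  also have "\<dots> = (\<Sum>j\<in>UNIV. \<Sum>l\<in>UNIV. \<Sum>k\<in>UNIV. h $ j * cnj (h $ k) * (cnj (\<phi> l $ j) * \<phi> l $ k))"
    by (rule sum.swap)
  also have "\<dots> = (\<Sum>j\<in>UNIV. \<Sum>k\<in>UNIV. h $ j * cnj (h $ k) * (\<Sum>l\<in>UNIV. cnj (\<phi> l $ j) * \<phi> l $ k))"
    unfolding sum_distrib_left by (intro sum.cong refl sum.swap)
  also have "\<dots> = (\<Sum>j\<in>UNIV. h $ j * cnj (h $ j))"
    by (simp add: orthonormal_basis_columns[OF assms] if_distrib[where f = "(*) _"] cong: if_cong)
  also have "\<dots> = complex_of_real ((norm h)\<^sup>2)"
    by (simp only: norm_vec_power2 of_real_sum complex_norm_square)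
  finally show ?thesis
    by (simp only: of_real_eq_iff)
qed

lemma frame_sum_eq:
  fixes \<phi> :: "'n::finite \<Rightarrow> complex ^ 'n"
  assumes "orthonormal_basis \<phi>"
  shows "(\<Sum>m=1..S. \<Sum>l\<in>UNIV. (cmod (cinner f (modulated_window \<phi> A g (m, l))))\<^sup>2)
    = (\<Sum>k\<in>UNIV. energy S A g $ k * (cmod (f $ k))\<^sup>2)"
proof -
  have "(\<Sum>l\<in>UNIV. (cmod (cinner f (modulated_window \<phi> A g (m, l))))\<^sup>2)
      = (\<Sum>k\<in>UNIV. (cmod ((A m *v g) $ k))\<^sup>2 * (cmod (f $ k))\<^sup>2)" for m
  proof -
    \<comment> \<open>The entrywise factor \<open>A m *v g\<close> moves to the other side of the
      inner product as its conjugate. What remains are the coefficients of \<open>h\<close> in the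
      basis, so Parseval applies for each \<open>m\<close>.\<close>
    define h :: "complex ^ 'n" where "h = (\<chi> k. f $ k * cnj ((A m *v g) $ k))"
    have "cinner f (modulated_window \<phi> A g (m, l)) = cinner h (\<phi> l)" for l
      by (simp add: cinner_def modulated_window_def h_def mult_ac)
    then show ?thesis
      by (simp add: parseval[OF assms] norm_vec_power2 h_def norm_mult power_mult_distrib mult_ac)
  qed
  then have "(\<Sum>m=1..S. \<Sum>l\<in>UNIV. (cmod (cinner f (modulated_window \<phi> A g (m, l))))\<^sup>2)
      = (\<Sum>m=1..S. \<Sum>k\<in>UNIV. (cmod ((A m *v g) $ k))\<^sup>2 * (cmod (f $ k))\<^sup>2)"
    by simp
  also have "\<dots> = (\<Sum>k\<in>UNIV. energy S A g $ k * (cmod (f $ k))\<^sup>2)"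
    unfolding energy_def vec_lambda_beta sum_distrib_right by (rule sum.swap)
  finally show ?thesis .
qed

text \<open>Testing the frame inequalities on the unit vector \<open>axis k 1\<close> isolates
  \<open>v k\<close>. This serves both the necessity of positive entries and the optimality of the
  bounds.\<close>

lemma frame_bounds_diagonal_imp:
  fixes v :: "'n::finite \<Rightarrow> real"
  assumes "frame_bounds X \<psi> a b"
    and "\<And>f. (\<Sum>x\<in>X. (cmod (cinner f (\<psi> x)))\<^sup>2) = (\<Sum>k\<in>UNIV. v k * (cmod (f $ k))\<^sup>2)"
  shows "a \<le> v k" "v k \<le> b"
proof -
  let ?e = "axis k 1 :: complex ^ 'n"
  have "(\<Sum>j\<in>UNIV. v j * (cmod (?e $ j))\<^sup>2) = (\<Sum>j\<in>UNIV. if k = j then v j else 0)"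
    by (intro sum.cong) (auto simp: axis_def)
  then have sum_eq: "(\<Sum>j\<in>UNIV. v j * (cmod (?e $ j))\<^sup>2) = v k"
    by simp
  have "norm ?e = 1"
    by simp
  with assms(1) sum_eq show "a \<le> v k" "v k \<le> b"
    unfolding frame_bounds_def assms(2) by (metis mult.right_neutral one_power2)+
qed

theorem theorem2:
  fixes \<phi> :: "'n::finite \<Rightarrow> complex ^ 'n"
    and A :: "nat \<Rightarrow> complex ^ 'n ^ 'n"
    and g :: "complex ^ 'n"
    and S :: nat
  assumes "S \<ge> 1"
    and "orthonormal_basis \<phi>"
  shows "(is_frame ({1..S} \<times> UNIV) (modulated_window \<phi> A g) \<longleftrightarrow> (\<forall>k. energy S A g $ k > 0)) \<and>
    ((\<forall>k. energy S A g $ k > 0) \<longrightarrow>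
      (\<forall>f :: complex ^ 'n.
        Min (range (\<lambda>k. energy S A g $ k)) * (norm f)\<^sup>2
          \<le> (\<Sum>m=1..S. \<Sum>l\<in>UNIV. (cmod (cinner f (modulated_window \<phi> A g (m, l))))\<^sup>2) \<and>
        (\<Sum>m=1..S. \<Sum>l\<in>UNIV. (cmod (cinner f (modulated_window \<phi> A g (m, l))))\<^sup>2)
          \<le> Max (range (\<lambda>k. energy S A g $ k)) * (norm f)\<^sup>2) \<and>
      optimal_frame_bounds ({1..S} \<times> UNIV) (modulated_window \<phi> A g)
        (Min (range (\<lambda>k. energy S A g $ k))) (Max (range (\<lambda>k. energy S A g $ k))))"
proof -
  let ?v = "\<lambda>k. energy S A g $ k"
  let ?X = "{1..S} \<times> (UNIV :: 'n set)"
  let ?w = "modulated_window \<phi> A g"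
  let ?sum = "\<lambda>f. \<Sum>m=1..S. \<Sum>l\<in>UNIV. (cmod (cinner f (?w (m, l))))\<^sup>2"
  note sum_eq = frame_sum_eq[OF assms(2), where S = S and A = A and g = g]
  have prod_eq: "(\<Sum>x\<in>?X. (cmod (cinner f (?w x)))\<^sup>2) = ?sum f" for f
    by (simp add: sum.cartesian_product)
  note bounds = frame_bounds_diagonal_imp[of ?X ?w _ _ ?v, unfolded prod_eq, OF _ sum_eq]
  \<comment> \<open>Both estimates hold term by term in the diagonal form, whatever the sign of the
    minimum.\<close>
  have lower: "Min (range ?v) * (norm f)\<^sup>2 \<le> ?sum f" for f
    unfolding sum_eq norm_vec_power2 sum_distrib_left by (intro sum_mono mult_right_mono) auto
  have upper: "?sum f \<le> Max (range ?v) * (norm f)\<^sup>2" for f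
    unfolding sum_eq norm_vec_power2 sum_distrib_left by (intro sum_mono mult_right_mono) auto
  have pos: "\<forall>k. ?v k > 0" if frame: "is_frame ?X ?w"
  proof -
    from frame obtain a b where ab: "frame_bounds ?X ?w a b"
      unfolding is_frame_def by blast
    then have "a > 0"
      by (simp add: frame_bounds_def)
    \<comment> \<open>The lower frame bound is positive and lies below every entry of the
      energy.\<close>
    with bounds(1)[OF ab] show ?thesis
      by (meson less_le_trans)
  qed
  have optimal: "optimal_frame_bounds ?X ?w (Min (range ?v)) (Max (range ?v))" if "\<forall>k. ?v k > 0"
  proof -
    \<comment> \<open>Over a finite nonempty index set the minimum is attained, so it inherits
      strict positivity.\<close>
    have "Min (range ?v) > 0" "Max (range ?v) > 0"
      using that by (auto simp: Max_gr_iff)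
    then have "frame_bounds ?X ?w (Min (range ?v)) (Max (range ?v))"
      unfolding frame_bounds_def prod_eq using lower upper by blast
    \<comment> \<open>Any frame bounds enclose every \<open>?v k\<close>, hence also the two extreme
      values.\<close>
    moreover have "a \<le> Min (range ?v)" "Max (range ?v) \<le> b" if "frame_bounds ?X ?w a b" for a b
      using bounds[OF that] by auto
    ultimately show ?thesis
      unfolding optimal_frame_bounds_def by blast
  qed
  then have "is_frame ?X ?w" if "\<forall>k. ?v k > 0"
    using that unfolding is_frame_def optimal_frame_bounds_def by auto
  with pos optimal lower upper show ?thesis
    by blast
qed

end
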